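(* Let $m>0$, $|a|<m$, $S<0$, $R,\widetilde R\in\mathbb R$, $X=S(\widetilde r-\widetilde R)$, and let $\widetilde{\mathbf g}$ be the transformed metric in the outgoing case, with rescaled inverse metric matrix $\widetilde{\mathbf H}$. Put $$X_-(\widetilde\theta)=-\frac{2|a\cos\widetilde\theta|}{m+|a\cos\widetilde\theta|},\qquad X_+(\widetilde\theta)=\frac{2|a\cos\widetilde\theta|}{m-|a\cos\widetilde\theta|}.$$ Away from the equatorial set $\cos\widetilde\theta=0$, the character of the rescaled metric and of $T=\partial_{\widetilde v}$ is as follows. - $X<-2$: Lorentzian, $T$ timelike. - $X=-2$: Lorentzian, $T$ null. - $-2<X<X_-(\widetilde\theta)$: Lorentzian, $T$ spacelike. - $X=X_-(\widetilde\theta)$: degenerate. - $X_-(\widetilde\theta)<X<0$: split signature $(2,2)$. - $X=0$: singular. - $0<X<X_+(\widetilde\theta)$: Riemannian. - $X=X_+(\widetilde\theta)$: degenerate. - $X>X_+(\widetilde\theta)$: Lorentzian, $T$ timelike.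
   Context: $\Delta(r)=r^2-2mr+a^2$. In coordinates $(\widetilde v,\widetilde r,\widetilde\varphi,\widetilde\theta)$, $0<\widetilde\theta<\pi$, the rescaled inverse metric is the symmetric matrix $$\widetilde{\mathbf H}=\begin{pmatrix}\widetilde{\mathbf h}^{\widetilde v\widetilde v}+a^2\sin^2\widetilde\theta&\widetilde{\mathbf h}^{\widetilde v\widetilde r}&a(1+X)&0\\ \widetilde{\mathbf h}^{\widetilde v\widetilde r}&\widetilde{\mathbf h}^{\widetilde r\widetilde r}&0&0\\ a(1+X)&0&\frac1{\sin^2\widetilde\theta}&0\\0&0&0&1\end{pmatrix},$$ $$\widetilde{\mathbf h}^{\widetilde r\widetilde r}=S^{-2}X(X+2),\quad\widetilde{\mathbf h}^{\widetilde v\widetilde r}=S^{-1}\big((R-m)X^2+2RX\big),\quad\widetilde{\mathbf h}^{\widetilde v\widetilde v}=\Delta(R)X^2+2(R^2+a^2)X .$$ $\widetilde{\mathbf H}$ is a positive conformal multiple of the inverse of $\widetilde{\mathbf g}$; the "rescaled metric" is the metric whose matrix is $\widetilde{\mathbf H}^{-1}$. Lorentzian means signature $(-,+,+,+)$. Degenerate or singular means $\det\widetilde{\mathbf H}=0$. Where $\widetilde{\mathbf H}$ is Lorentzian, $T$ is timelike, null or spacelike according as $(\widetilde{\mathbf H}^{-1})_{\widetilde v\widetilde v}$ is negative, zero or positive. *)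

theory Defs
  imports "HOL-Analysis.Analysis"
begin

definition Delta :: "real \<Rightarrow> real \<Rightarrow> real \<Rightarrow> real" where
  "Delta m a r = r^2 - 2 * m * r + a^2"

definition h_rr :: "real \<Rightarrow> real \<Rightarrow> real" where
  "h_rr S X = X * (X + 2) / S^2"

definition h_vr :: "real \<Rightarrow> real \<Rightarrow> real \<Rightarrow> real \<Rightarrow> real" where
  "h_vr m S R X = ((R - m) * X^2 + 2 * R * X) / S"

definition h_vv :: "real \<Rightarrow> real \<Rightarrow> real \<Rightarrow> real \<Rightarrow> real" where
  "h_vv m a R X = Delta m a R * X^2 + 2 * (R^2 + a^2) * X"

text \<open>
  Matrix of the rescaled inverse metric at a point with coordinates \<open>(v, r, \<phi>, \<theta>)\<close>, indexed by
  \<open>1, 2, 3, 4\<close> in that order.  The entries do not depend on \<open>v\<close> and \<open>\<phi>\<close>; \<open>Rt\<close> is the constant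
  written R-tilde, so that \<open>X = S * (r - Rt)\<close>.
\<close>
definition H_mat ::
  "real \<Rightarrow> real \<Rightarrow> real \<Rightarrow> real \<Rightarrow> real \<Rightarrow> real \<Rightarrow> real \<Rightarrow> real^4^4" where
  "H_mat m a S R Rt r \<theta> =
    (let X = S * (r - Rt) in
     vector
      [vector [h_vv m a R X + a^2 * (sin \<theta>)^2, h_vr m S R X, a * (1 + X), 0],
       vector [h_vr m S R X, h_rr S X, 0, 0],
       vector [a * (1 + X), 0, 1 / (sin \<theta>)^2, 0],
       vector [0, 0, 0, 1]])"

text \<open>
  \<open>has_signature G q p\<close>: in some basis (the columns of \<open>P\<close>) the bilinear form with matrix \<open>G\<close> is
  diagonal with exactly \<open>q\<close> negative and \<open>p\<close> positive entries and no zero entry.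
\<close>
definition has_signature :: "real^'n^'n \<Rightarrow> nat \<Rightarrow> nat \<Rightarrow> bool" where
  "has_signature G q p \<longleftrightarrow>
    (\<exists>(P :: real^'n^'n) d. invertible P \<and>
       transpose P ** G ** P = (\<chi> i j. if i = j then d i else 0) \<and>
       (\<forall>i. d i \<noteq> 0) \<and> card {i. d i < 0} = q \<and> card {i. d i > 0} = p)"

text \<open>
  The following predicates take the matrix \<open>H\<close> of an inverse metric and describe the metric with
  matrix \<open>matrix_inv H\<close>.  Since \<open>matrix_inv\<close> is unspecified on singular matrices, invertibility of
  \<open>H\<close> is required explicitly.
\<close>
definition degenerate :: "real^'n^'n \<Rightarrow> bool" where
  "degenerate H \<longleftrightarrow> det H = 0"

definition lorentzian :: "real^4^4 \<Rightarrow> bool" where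
  "lorentzian H \<longleftrightarrow> \<not> degenerate H \<and> has_signature (matrix_inv H) 1 3"

definition split_signature :: "real^4^4 \<Rightarrow> bool" where
  "split_signature H \<longleftrightarrow> \<not> degenerate H \<and> has_signature (matrix_inv H) 2 2"

definition riemannian :: "real^4^4 \<Rightarrow> bool" where
  "riemannian H \<longleftrightarrow> \<not> degenerate H \<and> transpose (matrix_inv H) = matrix_inv H \<and>
     (\<forall>x. x \<noteq> 0 \<longrightarrow> x \<bullet> (matrix_inv H *v x) > 0)"

text \<open>Causal character of the coordinate vector field \<open>T = \<partial>\<^sub>v\<close>; index \<open>1\<close> is \<open>v\<close>.\<close>

definition T_timelike :: "real^4^4 \<Rightarrow> bool" where
  "T_timelike H \<longleftrightarrow> matrix_inv H $ 1 $ 1 < 0"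

definition T_null :: "real^4^4 \<Rightarrow> bool" where
  "T_null H \<longleftrightarrow> matrix_inv H $ 1 $ 1 = 0"

definition T_spacelike :: "real^4^4 \<Rightarrow> bool" where
  "T_spacelike H \<longleftrightarrow> matrix_inv H $ 1 $ 1 > 0"

definition X_minus :: "real \<Rightarrow> real \<Rightarrow> real \<Rightarrow> real" where
  "X_minus m a \<theta> = - (2 * \<bar>a * cos \<theta>\<bar> / (m + \<bar>a * cos \<theta>\<bar>))"

definition X_plus :: "real \<Rightarrow> real \<Rightarrow> real \<Rightarrow> real" where
  "X_plus m a \<theta> = 2 * \<bar>a * cos \<theta>\<bar> / (m - \<bar>a * cos \<theta>\<bar>)"

end

theory Submission
  imports Defs
begin

text \<open>
  Write the entries of the inverse metric as \<open>A, b, c, h, k\<close> as in \<open>axial_mat\<close> below. Splitting off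
  the \<open>\<phi>\<close>-direction, where the form is positive, leaves the two-by-two block with rows \<open>(w, b)\<close>
  and \<open>(b, h)\<close>, where \<open>w = A - c\<^sup>2/k\<close>, so that the signature is read off the signs of \<open>h\<close> and of
  \<open>D = w h - b\<^sup>2\<close>, and \<open>(H\<^sup>-\<^sup>1)\<^sub>v\<^sub>v = h/D\<close>. For the given entries,
  \<open>h = X (X + 2) / S\<^sup>2\<close> and, all terms in \<open>R\<close> cancelling,
  \<open>D = X\<^sup>2 (a\<^sup>2 cos\<^sup>2 \<theta> (X + 2)\<^sup>2 - m\<^sup>2 X\<^sup>2) / S\<^sup>2\<close>, whose nonzero roots are \<open>X\<^sub>-\<close> and \<open>X\<^sub>+\<close>.
\<close>

lemma vector_4:
  "(vector [x, y, z, w] :: 'a::zero^4) $ 1 = x"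
  "(vector [x, y, z, w] :: 'a^4) $ 2 = y"
  "(vector [x, y, z, w] :: 'a^4) $ 3 = z"
  "(vector [x, y, z, w] :: 'a^4) $ 4 = w"
  by (simp_all add: vector_def)

lemma card_Collect_4:
  "card {i::4. Q i} = of_bool (Q 1) + of_bool (Q 2) + of_bool (Q 3) + of_bool (Q 4)"
proof -
  have "card {i::4. Q i} = (\<Sum>i\<in>UNIV. of_bool (Q i))" by simp
  then show ?thesis by (simp only: sum_4)
qed

section \<open>Signature and inversion of symmetric matrices\<close>

lemma has_signatureI:
  fixes G P :: "real^'n^'n"
  assumes "transpose P ** G ** P = (\<chi> i j. if i = j then d i else 0)"
    and "\<And>i. d i \<noteq> 0"
  shows "has_signature G (card {i. d i < 0}) (card {i. d i > 0})" "det G \<noteq> 0"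
proof -
  have "det (transpose P ** G ** P) = (\<Prod>i\<in>UNIV. d i)"
    unfolding assms(1) by (subst det_diagonal) auto
  moreover have "(\<Prod>i\<in>UNIV. d i) \<noteq> 0" using assms(2) by simp
  ultimately have "det P \<noteq> 0" "det G \<noteq> 0" by (auto simp: det_mul)
  then show "has_signature G (card {i. d i < 0}) (card {i. d i > 0})" "det G \<noteq> 0"
    unfolding has_signature_def using assms by (auto simp: invertible_det_nz)
qed

lemma matrix_inv_left_right:
  fixes G :: "real^'n^'n"
  assumes "det G \<noteq> 0"
  shows "matrix_inv G ** G = mat 1" "G ** matrix_inv G = mat 1"
proof -
  have "\<exists>B. G ** B = mat 1 \<and> B ** G = mat 1"
    using assms by (simp add: invertible_det_nz[symmetric] invertible_def)
  then have "G ** matrix_inv G = mat 1 \<and> matrix_inv G ** G = mat 1"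
    unfolding matrix_inv_def by (rule someI_ex)
  then show "matrix_inv G ** G = mat 1" "G ** matrix_inv G = mat 1" by auto
qed

text \<open>By symmetry of \<open>G\<close>, the basis \<open>G ** P\<close> gives the inverse form
  the same diagonal that \<open>P\<close> gives \<open>G\<close>.\<close>

lemma has_signature_matrix_inv:
  fixes G :: "real^'n^'n"
  assumes sym: "transpose G = G" and inv: "det G \<noteq> 0" and "has_signature G q p"
  shows "has_signature (matrix_inv G) q p"
proof -
  have G: "matrix_inv G ** G = mat 1"
    using inv by (rule matrix_inv_left_right)
  from assms(3) obtain P :: "real^'n^'n" and d where P: "invertible P"
    "transpose P ** G ** P = (\<chi> i j. if i = j then d i else 0)"
    "\<forall>i. d i \<noteq> 0" "card {i. d i < 0} = q" "card {i. d i > 0} = p"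
    unfolding has_signature_def by blast
  have "transpose (G ** P) ** matrix_inv G ** (G ** P)
      = transpose P ** G ** ((matrix_inv G ** G) ** P)"
    by (simp add: matrix_transpose_mul sym matrix_mul_assoc)
  also have "\<dots> = transpose P ** G ** P" by (simp add: G)
  finally have "transpose (G ** P) ** matrix_inv G ** (G ** P)
    = (\<chi> i j. if i = j then d i else 0)" by (simp only: P(2))
  moreover have "invertible (G ** P)"
    using P(1) inv by (simp add: invertible_det_nz det_mul)
  ultimately show ?thesis unfolding has_signature_def using P(3-5) by blast
qed

lemma transpose_matrix_inv:
  fixes G :: "real^'n^'n"
  assumes "transpose G = G" and "det G \<noteq> 0"
  shows "transpose (matrix_inv G) = matrix_inv G"
proof -
  have "transpose (matrix_inv G) ** G = mat 1"
    using assms by (metis matrix_inv_left_right(2) matrix_transpose_mul transpose_mat)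
  moreover have "G ** matrix_inv G = mat 1"
    using assms(2) by (rule matrix_inv_left_right)
  ultimately show ?thesis
    by (metis matrix_mul_assoc matrix_mul_lid matrix_mul_rid)
qed

text \<open>Substituting \<open>x = G *v y\<close> turns the inverse form at \<open>x\<close> into
  the form of \<open>G\<close> at \<open>y\<close>.\<close>

lemma matrix_inv_pos_def:
  fixes G :: "real^'n^'n"
  assumes "transpose G = G" and "det G \<noteq> 0" and "\<And>y. y \<noteq> 0 \<Longrightarrow> y \<bullet> (G *v y) > 0" and "x \<noteq> 0"
  shows "x \<bullet> (matrix_inv G *v x) > 0"
proof -
  define y where "y = matrix_inv G *v x"
  have x: "x = G *v y"
    using assms(2) by (simp add: y_def matrix_vector_mul_assoc matrix_inv_left_right)
  with assms(4) have "y \<noteq> 0" by auto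
  then have "y \<bullet> (G *v y) > 0" by (rule assms(3))
  then show ?thesis by (metis x y_def inner_commute)
qed

section \<open>Forms with the zero pattern of the rescaled inverse metric\<close>

definition axial_mat :: "real \<Rightarrow> real \<Rightarrow> real \<Rightarrow> real \<Rightarrow> real \<Rightarrow> real^4^4" where
  "axial_mat A b c h k = vector
    [vector [A, b, c, 0], vector [b, h, 0, 0], vector [c, 0, k, 0], vector [0, 0, 0, 1]]"

lemma transpose_axial_mat: "transpose (axial_mat A b c h k) = axial_mat A b c h k"
  by (simp add: axial_mat_def transpose_def vec_eq_iff forall_4 vector_4)

context
  fixes A b c h k w D :: real
  assumes k: "k > 0" and w: "w = A - c^2 / k" and D: "D = w * h - b^2"
begin

text \<open>The vector is chosen to annihilate rows 2 and 3. For \<open>D = 0\<close> it lies in the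
  kernel; for \<open>D < 0\<close>, dividing by \<open>D\<close> gives the first column of the
  inverse.\<close>

lemma axial_mat_kernel:
  "axial_mat A b c h k *v vector [h, - b, - (c * h / k), 0] = vector [D, 0, 0, 0]"
  using k by (simp add: axial_mat_def matrix_vector_mult_def vec_eq_iff forall_4 sum_4 vector_4
      w D field_simps power2_eq_square)

text \<open>Completing squares in the third and second coordinates leaves the pivots
  \<open>D / h\<close>, \<open>h\<close>, \<open>k\<close>, \<open>1\<close>; the last two are
  positive and account for the summand 2.\<close>

lemma axial_mat_signature:
  assumes "h \<noteq> 0" "D \<noteq> 0"
  shows "has_signature (axial_mat A b c h k)
      (of_bool (D / h < 0) + of_bool (h < 0)) (of_bool (D / h > 0) + of_bool (h > 0) + 2)"
    "det (axial_mat A b c h k) \<noteq> 0"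
proof -
  define \<beta> \<gamma> where "\<beta> = b / h" and "\<gamma> = c / k"
  \<comment> \<open>These substitutions remove all divisions, so that the congruence becomes a
    polynomial identity.\<close>
  have subst: "b = \<beta> * h" "c = \<gamma> * k" "A = w + \<gamma> * \<gamma> * k" "D / h = w - \<beta> * \<beta> * h"
    using k assms by (simp_all add: \<beta>_def \<gamma>_def w D power2_eq_square diff_divide_distrib)
  define P :: "real^4^4" where "P = vector
    [vector [1, 0, 0, 0], vector [- \<beta>, 1, 0, 0], vector [- \<gamma>, 0, 1, 0], vector [0, 0, 0, 1]]"
  define d :: "4 \<Rightarrow> real" where "d = ($) (vector [D / h, h, k, 1])"
  have "transpose P ** axial_mat A b c h k ** P = (\<chi> i j. if i = j then d i else 0)"
    unfolding P_def d_def axial_mat_def subst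
    by (simp add: transpose_def matrix_matrix_mult_def vec_eq_iff forall_4 sum_4 vector_4
        algebra_simps)
  moreover have "\<forall>i. d i \<noteq> 0" using k assms by (simp add: forall_4 d_def vector_4)
  ultimately have
    "has_signature (axial_mat A b c h k) (card {i. d i < 0}) (card {i. d i > 0})"
    "det (axial_mat A b c h k) \<noteq> 0" using has_signatureI by blast+
  then show "has_signature (axial_mat A b c h k)
      (of_bool (D / h < 0) + of_bool (h < 0)) (of_bool (D / h > 0) + of_bool (h > 0) + 2)"
    "det (axial_mat A b c h k) \<noteq> 0"
    using k by (simp_all only: card_Collect_4 d_def vector_4) auto
qed

lemma axial_mat_signature_null:
  assumes "h = 0" "b \<noteq> 0"
  shows "has_signature (axial_mat A b c h k) 1 3" "det (axial_mat A b c h k) \<noteq> 0"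
proof -
  text \<open>The block is a hyperbolic plane; the first two columns of \<open>P\<close> have squares \<open>1\<close> and \<open>-1\<close>.\<close>
  define P :: "real^4^4" where "P = vector
    [vector [1, 1, 0, 0], vector [(1 - w) / (2 * b), (- 1 - w) / (2 * b), 0, 0],
     vector [- c / k, - c / k, 1, 0], vector [0, 0, 0, 1]]"
  define d :: "4 \<Rightarrow> real" where "d = ($) (vector [1, - 1, k, 1])"
  have "transpose P ** axial_mat A b c h k ** P = (\<chi> i j. if i = j then d i else 0)"
    using k assms by (simp add: P_def d_def axial_mat_def transpose_def matrix_matrix_mult_def
        vec_eq_iff forall_4 sum_4 vector_4 w field_simps power2_eq_square)
  moreover have "\<forall>i. d i \<noteq> 0" using k by (simp add: forall_4 d_def vector_4)
  ultimately have
    "has_signature (axial_mat A b c h k) (card {i. d i < 0}) (card {i. d i > 0})"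
    "det (axial_mat A b c h k) \<noteq> 0" using has_signatureI by blast+
  then show "has_signature (axial_mat A b c h k) 1 3" "det (axial_mat A b c h k) \<noteq> 0"
    using k by (simp_all add: card_Collect_4 d_def vector_4 eval_nat_numeral)
qed

text \<open>For \<open>h \<noteq> 0\<close> the pivots \<open>h\<close> and \<open>D / h\<close>
  have opposite signs. For \<open>h = 0\<close>, which the theorem meets at \<open>X = -2\<close>,
  \<open>D = - b^2\<close> forces \<open>b \<noteq> 0\<close>.\<close>

lemma axial_mat_lorentzian:
  assumes "D < 0"
  shows "lorentzian (axial_mat A b c h k)"
proof (cases "h = 0")
  case True
  with assms D have "b \<noteq> 0" by auto
  with True show ?thesis
    unfolding lorentzian_def degenerate_def
    using axial_mat_signature_null has_signature_matrix_inv[OF transpose_axial_mat] by blast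
next
  case False
  have n: "of_bool (D / h < 0) + of_bool (h < 0) = (1::nat)"
    "of_bool (D / h > 0) + of_bool (h > 0) + 2 = (3::nat)"
    using assms False by (auto simp: divide_less_0_iff zero_less_divide_iff)
  from assms have "D \<noteq> 0" by simp
  from axial_mat_signature[OF False this] show ?thesis
    unfolding lorentzian_def degenerate_def n
    using has_signature_matrix_inv[OF transpose_axial_mat] by blast
qed

lemma axial_mat_split_signature:
  assumes "D > 0" "h < 0"
  shows "split_signature (axial_mat A b c h k)"
proof -
  have n: "of_bool (D / h < 0) + of_bool (h < 0) = (2::nat)"
    "of_bool (D / h > 0) + of_bool (h > 0) + 2 = (2::nat)"
    using assms by (auto simp: divide_less_0_iff zero_less_divide_iff)
  from assms have "h \<noteq> 0" "D \<noteq> 0" by simp_all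
  from axial_mat_signature[OF this] show ?thesis
    unfolding split_signature_def degenerate_def n
    using has_signature_matrix_inv[OF transpose_axial_mat] by blast
qed

text \<open>Since \<open>riemannian\<close> asks for positive definiteness, the form is written as a
  sum of squares with positive weights and the result is transferred to the inverse.\<close>

lemma axial_mat_riemannian:
  assumes "D > 0" "h > 0"
  shows "riemannian (axial_mat A b c h k)"
proof -
  have det: "det (axial_mat A b c h k) \<noteq> 0" using axial_mat_signature(2) assms by simp
  have "y \<bullet> (axial_mat A b c h k *v y) > 0" if "y \<noteq> 0" for y
  proof -
    have subst: "b = b / h * h" "c = c / k * k" "A = w + c / k * (c / k) * k"
      "D / h = w - b / h * (b / h) * h"
      using k assms by (simp_all add: w D power2_eq_square diff_divide_distrib)
    define \<beta> \<gamma> where "\<beta> = b / h" and "\<gamma> = c / k"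
    note subst = subst[folded \<beta>_def \<gamma>_def]
    have eq: "y \<bullet> (axial_mat A b c h k *v y) = (y$4)^2 + k * (y$3 + \<gamma> * y$1)^2
        + h * (y$2 + \<beta> * y$1)^2 + D / h * (y$1)^2"
      unfolding axial_mat_def subst
      by (simp add: matrix_vector_mult_def inner_vec_def sum_4 vector_4 algebra_simps
          power2_eq_square)
    have nn: "(y$4)^2 \<ge> 0" "k * (y$3 + \<gamma> * y$1)^2 \<ge> 0" "h * (y$2 + \<beta> * y$1)^2 \<ge> 0"
      "D / h * (y$1)^2 \<ge> 0" using k assms by simp_all
    have "y = 0" if "y \<bullet> (axial_mat A b c h k *v y) \<le> 0"
    proof -
      have z: "(y$4)^2 = 0" "k * (y$3 + \<gamma> * y$1)^2 = 0" "h * (y$2 + \<beta> * y$1)^2 = 0"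
        "D / h * (y$1)^2 = 0" using that nn unfolding eq by linarith+
      \<comment> \<open>Once \<open>y$1\<close> vanishes, the two shifted squares reduce to
        \<open>y$2\<close> and \<open>y$3\<close>.\<close>
      then have "y$1 = 0" "y$4 = 0" using assms by simp_all
      with z k assms show ?thesis by (simp add: vec_eq_iff forall_4)
    qed
    with \<open>y \<noteq> 0\<close> show ?thesis by force
  qed
  then show ?thesis
    unfolding riemannian_def degenerate_def
    using det transpose_matrix_inv matrix_inv_pos_def transpose_axial_mat by blast
qed

lemma axial_mat_degenerate:
  assumes "D = 0"
  shows "degenerate (axial_mat A b c h k)"
proof -
  have "\<exists>x. x \<noteq> 0 \<and> axial_mat A b c h k *v x = 0"
  proof (cases "h = 0")
    case True
    \<comment> \<open>Here the vector of \<open>axial_mat_kernel\<close> is zero, but the whole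
      second column vanishes.\<close>
    with assms D have "b = 0" by simp
    with True have "axial_mat A b c h k *v vector [0, 1, 0, 0] = 0"
      by (simp add: axial_mat_def matrix_vector_mult_def vec_eq_iff forall_4 sum_4 vector_4)
    moreover have "(vector [0, 1, 0, 0] :: real^4) \<noteq> 0"
      by (simp add: vec_eq_iff forall_4 vector_4)
    ultimately show ?thesis by blast
  next
    case False
    have "axial_mat A b c h k *v vector [h, - b, - (c * h / k), 0] = 0"
      unfolding axial_mat_kernel by (simp add: assms vec_eq_iff forall_4 vector_4)
    moreover have "(vector [h, - b, - (c * h / k), 0] :: real^4) \<noteq> 0"
      using False by (simp add: vec_eq_iff forall_4 vector_4)
    ultimately show ?thesis by blast
  qed
  then show ?thesis unfolding degenerate_def 
    by (metis invertible_det_nz invertible_left_inverse matrix_left_invertible_ker)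
qed

lemma matrix_inv_axial_mat_11:
  assumes "D < 0"
  shows "matrix_inv (axial_mat A b c h k) $ 1 $ 1 = h / D"
proof -
  let ?H = "axial_mat A b c h k"
  have "det ?H \<noteq> 0"
    using axial_mat_lorentzian[OF assms] by (simp add: lorentzian_def degenerate_def)
  then have "matrix_inv ?H ** ?H = mat 1" by (rule matrix_inv_left_right)
  then have "vector [h, - b, - (c * h / k), 0] = matrix_inv ?H *v vector [D, 0, 0, 0]"
    by (metis axial_mat_kernel matrix_vector_mul_assoc matrix_vector_mul_lid)
  then have "(vector [h, - b, - (c * h / k), 0] :: real^4) $ 1
      = (matrix_inv ?H *v vector [D, 0, 0, 0]) $ 1" by (rule arg_cong)
  then have "h = matrix_inv ?H $ 1 $ 1 * D"
    by (simp add: matrix_vector_mult_def sum_4 vector_4)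
  then show ?thesis using assms by (simp add: field_simps)
qed

end

section \<open>Signs of \<open>D\<close> and \<open>h\<close> for the given entries\<close>

theorem proposition3p15:
  fixes m a S R Rt r \<theta> X :: real and H :: "real^4^4"
  assumes "m > 0" and "\<bar>a\<bar> < m" and "S < 0"
    and "0 < \<theta>" and "\<theta> < pi" and "cos \<theta> \<noteq> 0"
    and "X = S * (r - Rt)"
    and "H = H_mat m a S R Rt r \<theta>"
  shows "(X < -2 \<longrightarrow> lorentzian H \<and> T_timelike H) \<and>
    (X = -2 \<longrightarrow> lorentzian H \<and> T_null H) \<and>
    (-2 < X \<and> X < X_minus m a \<theta> \<longrightarrow> lorentzian H \<and> T_spacelike H) \<and>
    (X = X_minus m a \<theta> \<longrightarrow> degenerate H) \<and>
    (X_minus m a \<theta> < X \<and> X < 0 \<longrightarrow> split_signature H) \<and>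
    (X = 0 \<longrightarrow> degenerate H) \<and>
    (0 < X \<and> X < X_plus m a \<theta> \<longrightarrow> riemannian H) \<and>
    (X = X_plus m a \<theta> \<longrightarrow> degenerate H) \<and>
    (X > X_plus m a \<theta> \<longrightarrow> lorentzian H \<and> T_timelike H)"
proof -
  define \<alpha> where "\<alpha> = \<bar>a * cos \<theta>\<bar>"
  have "\<bar>a * cos \<theta>\<bar> \<le> \<bar>a\<bar>"
    by (simp add: abs_mult mult_left_le)
  then have \<alpha>: "0 \<le> \<alpha>" "\<alpha> < m" using assms(2) by (simp_all add: \<alpha>_def)
  define A b c h k where "A = h_vv m a R X + a^2 * (sin \<theta>)^2" and "b = h_vr m S R X"
    and "c = a * (1 + X)" and "h = h_rr S X" and "k = 1 / (sin \<theta>)^2"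
  define w D where "w = A - c^2 / k" and "D = w * h - b^2"
  have s: "sin \<theta> > 0" using assms(4,5) by (rule sin_gt_zero)
  then have k: "k > 0" by (simp add: k_def)
  have H: "H = axial_mat A b c h k"
    by (simp add: assms(7,8) H_mat_def axial_mat_def A_def b_def c_def h_def k_def Let_def)
  have hS: "h = X * (X + 2) / S^2" by (simp add: h_def h_rr_def)
  have DS: "D = X^2 / S^2 * ((\<alpha> * (X + 2) - m * X) * (\<alpha> * (X + 2) + m * X))"
  proof -
    have "\<alpha>^2 = a^2 * (1 - (sin \<theta>)^2)"
      by (simp add: \<alpha>_def power_mult_distrib cos_squared_eq)
    then have sq: "a^2 * (sin \<theta>)^2 = a^2 - \<alpha>^2" by (simp add: algebra_simps)
    \<comment> \<open>This uses \<open>(1 + X)^2 - 1 = X * (X + 2)\<close>.\<close>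
    have "w = h_vv m a R X - (a^2 * (sin \<theta>)^2) * (X * (X + 2))"
      using s by (simp add: w_def A_def c_def k_def power2_eq_square algebra_simps)
    then have w: "w = X * ((R^2 + \<alpha>^2) * (X + 2) - 2 * m * R * X)"
      unfolding sq h_vv_def Delta_def by (simp add: power2_eq_square algebra_simps)
    have "S^2 * D = w * (X * (X + 2)) - ((R - m) * X^2 + 2 * R * X)^2"
      using assms(3) by (simp add: D_def hS b_def h_vr_def field_simps power2_eq_square)
    \<comment> \<open>The subtracted square is that of \<open>X * (R * (X + 2) - m * X)\<close>; its
      terms in \<open>R\<close> cancel against \<open>w\<close>, leaving a difference of
      squares.\<close>
    also have "\<dots> = X^2 * ((\<alpha> * (X + 2) - m * X) * (\<alpha> * (X + 2) + m * X))"
      unfolding w by (simp add: power2_eq_square algebra_simps)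
    finally show ?thesis using assms(3) by (simp add: field_simps)
  qed
  have S2: "S^2 > 0" using assms(3) by simp
  \<comment> \<open>The first factor of \<open>D\<close> has slope \<open>\<alpha> - m < 0\<close>
    in \<open>X\<close> and root \<open>X_plus\<close>; the second has slope
    \<open>\<alpha> + m > 0\<close> and root \<open>X_minus\<close>.\<close>
  have p: "X < X_plus m a \<theta> \<longleftrightarrow> \<alpha> * (X + 2) - m * X > 0"
    "X = X_plus m a \<theta> \<longleftrightarrow> \<alpha> * (X + 2) - m * X = 0"
    "X > X_plus m a \<theta> \<longleftrightarrow> \<alpha> * (X + 2) - m * X < 0"
    using \<alpha> by (auto simp: X_plus_def \<alpha>_def[symmetric] field_simps)
  have X_minus: "X_minus m a \<theta> = (- 2 * \<alpha>) / (m + \<alpha>)" by (simp add: X_minus_def \<alpha>_def)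
  have n: "X < X_minus m a \<theta> \<longleftrightarrow> \<alpha> * (X + 2) + m * X < 0"
    "X = X_minus m a \<theta> \<longleftrightarrow> \<alpha> * (X + 2) + m * X = 0"
    "X > X_minus m a \<theta> \<longleftrightarrow> \<alpha> * (X + 2) + m * X > 0"
    unfolding X_minus using \<alpha> assms(1) by (auto simp: field_simps)
  have xp: "X_plus m a \<theta> \<ge> 0" using \<alpha> by (simp add: X_plus_def \<alpha>_def[symmetric])
  have xm: "X_minus m a \<theta> \<le> 0" "X_minus m a \<theta> > -2"
    using \<alpha> assms(1) by (simp_all add: X_minus_def \<alpha>_def[symmetric] field_simps)
  \<comment> \<open>Outside the interval between the roots exactly one factor is negative, and
    \<open>X \<noteq> 0\<close> because the interval contains 0.\<close>
  have D_neg: "D < 0" if "X < X_minus m a \<theta> \<or> X > X_plus m a \<theta>"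
  proof -
    have "(\<alpha> * (X + 2) - m * X) * (\<alpha> * (X + 2) + m * X) < 0"
      using that n p xp xm by (smt (verit) mult_neg_pos mult_pos_neg)
    moreover have "X^2 / S^2 > 0" using S2 that xp xm by auto
    ultimately show ?thesis unfolding DS by (rule mult_pos_neg[rotated])
  qed
  have D_pos: "D > 0" if "X_minus m a \<theta> < X" "X < X_plus m a \<theta>" "X \<noteq> 0"
    unfolding DS using that n p S2 by simp
  have D_zero: "D = 0" if "X = X_minus m a \<theta> \<or> X = X_plus m a \<theta> \<or> X = 0"
    unfolding DS using that n p by auto
  have h_sgn: "h > 0 \<longleftrightarrow> X < -2 \<or> X > 0" "h = 0 \<longleftrightarrow> X = -2 \<or> X = 0"
    "h < 0 \<longleftrightarrow> -2 < X \<and> X < 0"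
    using S2 by (auto simp: hS zero_less_divide_iff divide_less_0_iff zero_less_mult_iff
        mult_less_0_iff)
  note facts = k w_def D_def
  \<comment> \<open>The entry \<open>h / D\<close> has the sign opposite to that of
    \<open>h\<close>.\<close>
  have T: "T_timelike H \<longleftrightarrow> h > 0" "T_null H \<longleftrightarrow> h = 0" "T_spacelike H \<longleftrightarrow> h < 0" if "D < 0"
    unfolding T_timelike_def T_null_def T_spacelike_def H matrix_inv_axial_mat_11[OF facts that]
    using that by (auto simp: divide_less_0_iff zero_less_divide_iff)
  have L: "lorentzian H" if "D < 0" unfolding H by (rule axial_mat_lorentzian[OF facts that])
  have G: "degenerate H" if "D = 0" unfolding H by (rule axial_mat_degenerate[OF facts that])
  have Sp: "split_signature H" if "D > 0" "h < 0"
    unfolding H by (rule axial_mat_split_signature[OF facts that])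
  have Ri: "riemannian H" if "D > 0" "h > 0"
    unfolding H by (rule axial_mat_riemannian[OF facts that])
  show ?thesis
  proof (intro conjI impI; (elim conjE)?)
    show "lorentzian H" "T_timelike H" if "X < -2"
      using that xm D_neg L T h_sgn by auto
    show "lorentzian H" "T_null H" if "X = -2"
      using that xm D_neg L T h_sgn by auto
    show "lorentzian H" "T_spacelike H" if "-2 < X" "X < X_minus m a \<theta>"
      using that xm D_neg L T h_sgn by auto
    show "split_signature H" if "X_minus m a \<theta> < X" "X < 0"
      using that xm xp D_pos Sp h_sgn by auto
    show "riemannian H" if "0 < X" "X < X_plus m a \<theta>"
      using that xm xp D_pos Ri h_sgn by auto
    show "lorentzian H" "T_timelike H" if "X > X_plus m a \<theta>"
      using that xp D_neg L T h_sgn by auto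
  \<comment> \<open>What remains are the three degenerate values \<open>X_minus\<close>, 0 and
    \<open>X_plus\<close>.\<close>
  qed (use D_zero G in auto)
qed

end
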